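(* Let $G$ be a $1$-dimensional finite abstract simplicial complex with $n=|G|$ simplices and connection Laplacian $L$. Let $p_0,\dots,p_n$ be the coefficients of the characteristic polynomial of $L^2$, in the sign convention $$\det(L^2-xI)=p_0(-x)^n+\cdots+p_k(-x)^{n-k}+\cdots+p_n .$$ Then $p_{n-k}=p_k$ for all $0\le k\le n$.
   Context: A finite abstract simplicial complex $G$ is a finite set of non-empty finite sets (simplices) closed under taking non-empty subsets; it is $1$-dimensional if every $x\in G$ has $|x|\le2$ and at least one $x\in G$ has $|x|=2$. The connection Laplacian $L$ is the $|G|\times|G|$ matrix indexed by $G$ with $L(x,y)=1$ if $x\cap y\ne\emptyset$ and $0$ otherwise. *)

theory Defs
  imports Complex_Main "Jordan_Normal_Form.Determinant"
begin

definition simplicial_complex :: "'a set set \<Rightarrow> bool" where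
  "simplicial_complex G \<longleftrightarrow>
     finite G \<and> (\<forall>x\<in>G. finite x \<and> x \<noteq> {}) \<and>
     (\<forall>x\<in>G. \<forall>y. y \<subseteq> x \<and> y \<noteq> {} \<longrightarrow> y \<in> G)"

definition one_dimensional :: "'a set set \<Rightarrow> bool" where
  "one_dimensional G \<longleftrightarrow> (\<forall>x\<in>G. card x \<le> 2) \<and> (\<exists>x\<in>G. card x = 2)"

(* Matrices are indexed by natural numbers, so a matrix indexed by a complex G is taken with
   respect to an enumeration xs of G, that is, distinct xs and set xs = G. *)
definition connection_laplacian :: "'a set list \<Rightarrow> real mat" where
  "connection_laplacian xs =
     mat (length xs) (length xs) (\<lambda>(i, j). if xs ! i \<inter> xs ! j \<noteq> {} then 1 else 0)"

end

theory Submission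
  imports Defs
begin

text \<open>
  The palindromic symmetry says that \<open>L * L\<close> and its inverse have the same characteristic
  polynomial. Let \<open>B\<close> be the unsigned vertex-edge incidence matrix. Two distinct edges share at
  most one vertex, so \<open>B\<^sup>T * B\<close> agrees with the edge-edge block of \<open>L\<close> up to an identity matrix, and
  with the vertices listed first

    \<open>L = [1, B; B\<^sup>T, B\<^sup>T * B - 1] = [1, 0; B\<^sup>T, 1] * [1, 0; 0, -1] * [1, B; 0, 1]\<close>.

  With \<open>N = [0, 0; B\<^sup>T, 0]\<close> and \<open>J = [1, 0; 0, -1]\<close> this reads \<open>L = (1 + N) * J * (1 + N\<^sup>T)\<close>, hence
  \<open>L\<close> has the inverse \<open>K = (1 - N\<^sup>T) * J * (1 - N)\<close>. The antisymmetric matrix \<open>S = N - N\<^sup>T\<close>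
  satisfies two identities: \<open>L - K = - S * S\<close>, whose right-hand side is the sign-free Hodge
  Laplacian \<open>diag(B * B\<^sup>T, B\<^sup>T * B)\<close>, and \<open>L * S = - S * K\<close>. Multiplying the first one by \<open>L\<close>
  or by \<open>K\<close> and using the second one gives

    \<open>L * L = 1 + S * (K * S)\<close> and \<open>K * K = 1 + (K * S) * S\<close>.

  The two products on the right differ only in the order of their factors, so by Sylvester's
  determinant identity the two squares have the same characteristic polynomial. At \<open>0\<close> this
  forces \<open>det (L * L) = 1\<close>, and \<open>det (L * L - x) = (- x) ^ n * det (L * L - 1 / x)\<close> follows;
  comparing coefficients finishes the proof.

  For an arbitrary enumeration of the simplices, \<open>N\<close> is the matrix with entry \<open>1\<close> at \<open>(x, y)\<close> when
  \<open>y\<close> is a proper face of \<open>x\<close>, and \<open>J\<close> is the diagonal matrix of the signs \<open>(- 1) ^ dim x\<close>. The block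
  calculus is then replaced by the relations \<open>J * J = 1\<close>, \<open>N * N = 0\<close>, \<open>J * N = - N\<close>, \<open>N * J = N\<close> and their transposes.
\<close>

section \<open>Matrices whose square is isospectral to its inverse\<close>

text \<open>
  For \<open>c \<noteq> 0\<close>, both sides are obtained from the block matrix \<open>[c, - X; Y, 1]\<close>: the right-hand
  side by clearing its upper right block, the left-hand side because its lower blocks commute.
\<close>


lemma det_scalar_plus_mult_commute:
  fixes X Y :: "'a :: idom mat"
  assumes X: "X \<in> carrier_mat n n" and Y: "Y \<in> carrier_mat n n"
  shows "det (c \<cdot>\<^sub>m 1\<^sub>m n + X * Y) = det (c \<cdot>\<^sub>m 1\<^sub>m n + Y * X)"
proof (cases "c = 0")
  case True
  then have "c \<cdot>\<^sub>m 1\<^sub>m n + X * Y = X * Y" "c \<cdot>\<^sub>m 1\<^sub>m n + Y * X = Y * X"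
    using X Y by (auto intro!: eq_matI)
  then show ?thesis
    using X Y by (simp add: det_mult mult.commute)
next
  case False
  let ?M = "four_block_mat (c \<cdot>\<^sub>m 1\<^sub>m n) (- X) Y (1\<^sub>m n)"
  let ?U = "four_block_mat (1\<^sub>m n) X (0\<^sub>m n n) (c \<cdot>\<^sub>m 1\<^sub>m n)"
  have M: "?M \<in> carrier_mat (n + n) (n + n)" and U: "?U \<in> carrier_mat (n + n) (n + n)"
    by auto
  have "det ?M = det (c \<cdot>\<^sub>m 1\<^sub>m n * 1\<^sub>m n - (- X) * Y)"
    by (rule det_four_block_mat) (use X Y in auto)
  also have "c \<cdot>\<^sub>m 1\<^sub>m n * 1\<^sub>m n - (- X) * Y = c \<cdot>\<^sub>m 1\<^sub>m n + X * Y"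
    using X Y by (auto intro!: eq_matI)
  finally have detM: "det ?M = det (c \<cdot>\<^sub>m 1\<^sub>m n + X * Y)" .
  have detU: "det ?U = c ^ n"
    by (subst det_four_block_mat_lower_left_zero[of _ n _ n]) (use X in auto)
  have prod: "?M * ?U = four_block_mat (c \<cdot>\<^sub>m 1\<^sub>m n) (0\<^sub>m n n) Y (c \<cdot>\<^sub>m 1\<^sub>m n + Y * X)"
  proof -
    have "c \<cdot>\<^sub>m 1\<^sub>m n * X + (- X) * (c \<cdot>\<^sub>m 1\<^sub>m n) = 0\<^sub>m n n"
      using X by (auto simp: mult_smult_distrib[of _ n n _ n] mult_smult_assoc_mat[of _ n n _ n] intro!: eq_matI)
    moreover have "Y * X + 1\<^sub>m n * (c \<cdot>\<^sub>m 1\<^sub>m n) = c \<cdot>\<^sub>m 1\<^sub>m n + Y * X"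
      using X Y by (simp add: comm_add_mat[of _ n n])
    ultimately show ?thesis
      using X Y by (subst mult_four_block_mat[of _ n n _ n _ n _ _ n _ n]) auto
  qed
  have "det ?M * c ^ n = det (?M * ?U)"
    using det_mult[OF M U] by (simp add: detU)
  also have "\<dots> = c ^ n * det (c \<cdot>\<^sub>m 1\<^sub>m n + Y * X)"
    unfolding prod
    by (subst det_four_block_mat_upper_right_zero[of _ n _ n]) (use X Y in auto)
  finally show ?thesis
    using False detM by simp
qed

text \<open>
  The hypotheses give \<open>L * L - 1 = L * (L - K) = S * (K * S)\<close> and
  \<open>K * K - 1 = - K * (L - K) = (K * S) * S\<close>.
\<close>

lemma det_square_shift_eq_det_inverse_square_shift:
  fixes L K S :: "'a :: idom mat"
  assumes L: "L \<in> carrier_mat n n" and K: "K \<in> carrier_mat n n" and S: "S \<in> carrier_mat n n"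
    and LK: "L * K = 1\<^sub>m n" and KL: "K * L = 1\<^sub>m n"
    and hodge: "L - K = - (S * S)" and intertwine: "L * S = - (S * K)"
  shows "det (L * L - x \<cdot>\<^sub>m 1\<^sub>m n) = det (K * K - x \<cdot>\<^sub>m 1\<^sub>m n)"
proof -
  have "L * L - 1\<^sub>m n = L * (L - K)"
    using L K by (simp add: LK mult_minus_distrib_mat[of _ n n _ n])
  also have "\<dots> = - (L * S * S)"
    using L S by (simp add: hodge assoc_mult_mat[of _ n n _ n _ n])
  also have "\<dots> = S * (K * S)"
    using K S by (simp add: intertwine assoc_mult_mat[of _ n n _ n _ n])
  finally have LL: "L * L - 1\<^sub>m n = S * (K * S)" .
  have "K * K - 1\<^sub>m n = - (K * (L - K))"
    using L K by (auto simp: KL mult_minus_distrib_mat[of _ n n _ n] simp del: index_mult_mat(1) intro!: eq_matI)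
  also have "\<dots> = (K * S) * S"
    using K S by (simp add: hodge assoc_mult_mat[of _ n n _ n _ n])
  finally have KK: "K * K - 1\<^sub>m n = (K * S) * S" .
  have shift: "A - x \<cdot>\<^sub>m 1\<^sub>m n = (1 - x) \<cdot>\<^sub>m 1\<^sub>m n + (A - 1\<^sub>m n)" if "A \<in> carrier_mat n n" for A
    using that by (auto simp: algebra_simps intro!: eq_matI)
  show ?thesis
    using L K S
    by (simp add: shift[of "L * L"] shift[of "K * K"] LL KK
        det_scalar_plus_mult_commute[of S n "K * S"])
qed

text \<open>
  Since \<open>L * L * (K * K - 1 / x) = 1 - L * L / x\<close>, isospectrality of \<open>L * L\<close> and \<open>K * K\<close>
  turns into a functional equation for \<open>L * L\<close> alone, up to the factor \<open>det (L * L)\<close>.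
\<close>

lemma det_square_reciprocal:
  fixes L K S :: "'a :: linordered_field mat"
  assumes L: "L \<in> carrier_mat n n" and K: "K \<in> carrier_mat n n" and S: "S \<in> carrier_mat n n"
    and LK: "L * K = 1\<^sub>m n"
    and hodge: "L - K = - (S * S)" and intertwine: "L * S = - (S * K)"
    and x: "x \<noteq> 0"
  shows "det (L * L - x \<cdot>\<^sub>m 1\<^sub>m n) = (- x) ^ n * det (L * L - (1 / x) \<cdot>\<^sub>m 1\<^sub>m n)"
proof -
  have KL: "K * L = 1\<^sub>m n"
    by (rule mat_mult_left_right_inverse[OF L K LK])
  note swap = det_square_shift_eq_det_inverse_square_shift[OF L K S LK KL hodge intertwine]
  have LLKK: "L * L * (K * K) = 1\<^sub>m n"
  proof -
    have "L * L * (K * K) = L * (L * K) * K"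
      using L K by (simp add: assoc_mult_mat[of _ n n _ n _ n])
    then show ?thesis
      using L K by (simp add: LK)
  qed
  \<comment> \<open>Isospectrality at \<open>0\<close> gives only \<open>det (L * L) ^ 2 = 1\<close>; a square excludes \<open>- 1\<close>.\<close>
  have detLL: "det (L * L) = 1"
  proof -
    have zero: "A - 0 \<cdot>\<^sub>m 1\<^sub>m n = A" if "A \<in> carrier_mat n n" for A :: "'a mat"
      using that by (auto intro!: eq_matI)
    have "det (L * L) = det (K * K)"
      using swap[of 0] L K by (simp add: zero)
    then have "det L * det L = det K * det K"
      using L K by (simp add: det_mult)
    moreover have "det L * det K = 1"
      using L K LK det_mult[OF L K] by simp
    ultimately have "(det L * det L) ^ 2 = 1"
      by (metis (no_types, lifting) mult.assoc mult.commute mult_1 power2_eq_square)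
    then show ?thesis
      using L by (simp add: det_mult power2_eq_1_iff)
        (metis less_minus_one_simps(1) not_less zero_le_square)
  qed
  have "det (L * L - (1 / x) \<cdot>\<^sub>m 1\<^sub>m n) = det (L * L) * det (K * K - (1 / x) \<cdot>\<^sub>m 1\<^sub>m n)"
    by (simp add: swap detLL)
  also have "\<dots> = det (L * L * (K * K - (1 / x) \<cdot>\<^sub>m 1\<^sub>m n))"
    using L K by (subst det_mult[of _ n]) auto
  also have "L * L * (K * K - (1 / x) \<cdot>\<^sub>m 1\<^sub>m n) = 1\<^sub>m n - (1 / x) \<cdot>\<^sub>m (L * L)"
    using L K by (simp add: mult_minus_distrib_mat[of _ n n _ n] LLKK mult_smult_distrib[of _ n n _ n])
  also have "\<dots> = (- (1 / x)) \<cdot>\<^sub>m (L * L - x \<cdot>\<^sub>m 1\<^sub>m n)"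
    using L x by (auto simp del: index_mult_mat(1) simp: field_simps intro!: eq_matI)
  also have "det \<dots> = (- (1 / x)) ^ n * det (L * L - x \<cdot>\<^sub>m 1\<^sub>m n)"
    using L by simp
  finally have "(- x) ^ n * det (L * L - (1 / x) \<cdot>\<^sub>m 1\<^sub>m n)
      = ((- x) * (- (1 / x))) ^ n * det (L * L - x \<cdot>\<^sub>m 1\<^sub>m n)"
    by (simp only: power_mult_distrib mult.assoc)
  then show ?thesis
    using x by simp
qed

text \<open>
  Here \<open>L\<close> and \<open>K\<close> are the expanded products \<open>(1 + N) * J * (1 + T)\<close> and
  \<open>(1 - T) * J * (1 - N)\<close>. In the model \<open>J = [1, 0; 0, -1]\<close> the matrix \<open>N\<close> is a lower
  left block and \<open>T\<close> an upper right block; the hypotheses are the word relations that this shape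
  implies, and they determine all the products below.
\<close>

lemma graded_factorization_relations:
  fixes J N T :: "'a :: comm_ring_1 mat"
  assumes J: "J \<in> carrier_mat n n" and N: "N \<in> carrier_mat n n" and T: "T \<in> carrier_mat n n"
    and JJ: "J * J = 1\<^sub>m n" and NN: "N * N = 0\<^sub>m n n" and TT: "T * T = 0\<^sub>m n n"
    and JN: "J * N = - N" and NJ: "N * J = N" and JT: "J * T = T" and TJ: "T * J = - T"
  defines "L \<equiv> J + N + T + N * T" and "K \<equiv> J + N + T - T * N" and "S \<equiv> N - T"
  shows "L * K = 1\<^sub>m n" and "L - K = - (S * S)" and "L * S = - (S * K)"
proof -
  \<comment> \<open>The relations again, now for words that continue to the right, so that rewriting
    reaches a normal form among right-nested products.\<close>
  have JJX: "J * (J * X) = X" and NNX: "N * (N * X) = 0\<^sub>m n n" and TTX: "T * (T * X) = 0\<^sub>m n n"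
    and JNX: "J * (N * X) = - (N * X)" and NJX: "N * (J * X) = N * X"
    and JTX: "J * (T * X) = T * X" and TJX: "T * (J * X) = - (T * X)"
    if "X \<in> carrier_mat n n" for X
    using J N T that by (simp_all flip: assoc_mult_mat[of _ n n _ n _ n] add: JJ NN TT JN NJ JT TJ)
  note expand = L_def K_def S_def JJ NN TT JN NJ JT TJ JJX NNX TTX JNX NJX JTX TJX
    add_mult_distrib_mat[of _ n n _ _ n] mult_add_distrib_mat[of _ n n _ n]
    minus_mult_distrib_mat[of _ n n _ _ n] mult_minus_distrib_mat[of _ n n _ n]
    assoc_mult_mat[of _ n n _ n _ n] minus_carrier_mat
  show "L * K = 1\<^sub>m n" "L - K = - (S * S)" "L * S = - (S * K)"
    using J N T by (simp_all add: expand, auto simp del: index_mult_mat(1) intro!: eq_matI)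
qed

section \<open>The connection matrix of a one-dimensional complex\<close>

lemma card_simplex_cases:
  assumes "simplicial_complex G" "one_dimensional G" "x \<in> G"
  shows "card x = 1 \<or> card x = 2"
proof -
  have "finite x" "x \<noteq> {}"
    using assms(1,3) unfolding simplicial_complex_def by blast+
  then have "card x \<noteq> 0"
    by simp
  moreover have "card x \<le> 2"
    using assms(2,3) unfolding one_dimensional_def by blast
  ultimately show ?thesis by linarith
qed

lemma proper_face_cards:
  assumes "simplicial_complex G" "one_dimensional G" "x \<in> G" "z \<in> G" "z \<subset> x"
  shows "card z = 1" and "card x = 2"
proof -
  have "finite x"
    using assms(1,3) unfolding simplicial_complex_def by blast
  then have "card z < card x"
    using assms(5) by (rule psubset_card_mono)
  then show "card z = 1" "card x = 2"
    using card_simplex_cases[OF assms(1,2,3)] card_simplex_cases[OF assms(1,2,4)] by auto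
qed

text \<open>
  A proper face is a vertex of an edge, so two edges have one common proper face for each
  common vertex, and a vertex has no proper faces.
\<close>

lemma card_common_proper_faces:
  assumes G: "simplicial_complex G" "one_dimensional G" and x: "x \<in> G" and y: "y \<in> G"
  shows "card {z \<in> G. z \<subset> x \<and> z \<subset> y} = (if card x = 2 \<and> card y = 2 then card (x \<inter> y) else 0)"
proof (cases "card x = 2 \<and> card y = 2")
  case True
  have "{z \<in> G. z \<subset> x \<and> z \<subset> y} = (\<lambda>v. {v}) ` (x \<inter> y)"
  proof (intro equalityI subsetI)
    fix z assume z: "z \<in> {z \<in> G. z \<subset> x \<and> z \<subset> y}"
    then have "card z = 1"
      using proper_face_cards(1)[OF G x] by auto
    then obtain v where "z = {v}" by (rule card_1_singletonE)
    then show "z \<in> (\<lambda>v. {v}) ` (x \<inter> y)"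
      using z by auto
  next
    fix z assume "z \<in> (\<lambda>v. {v}) ` (x \<inter> y)"
    then obtain v where v: "z = {v}" "v \<in> x" "v \<in> y" by auto
    then have "z \<in> G"
      using G(1) x unfolding simplicial_complex_def by blast
    moreover have "z \<noteq> x" "z \<noteq> y"
      using True v by auto
    ultimately show "z \<in> {z \<in> G. z \<subset> x \<and> z \<subset> y}"
      using v by auto
  qed
  then show ?thesis
    using True by (simp add: card_image)
next
  case False
  then have none: "{z \<in> G. z \<subset> x \<and> z \<subset> y} = {}"
    using proper_face_cards(2)[OF G] x y by blast
  show ?thesis
    unfolding none using False by auto
qed

text \<open>
  The summands are the entries of \<open>J\<close>, \<open>N\<close>, \<open>N\<^sup>T\<close> and \<open>N * N\<^sup>T\<close>. On the diagonal an edge has two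
  common vertices with itself, which the sign \<open>- 1\<close> corrects to \<open>1\<close>; two distinct edges have at
  most one common vertex, so there the number of common faces is the indicator itself.
\<close>

lemma intersection_indicator:
  assumes G: "simplicial_complex G" "one_dimensional G" and x: "x \<in> G" and y: "y \<in> G"
  shows "(if x \<inter> y \<noteq> {} then 1 else 0 :: real) =
    (if x = y then if card x = 1 then 1 else - 1 else 0)
      + (if y \<subset> x then 1 else 0) + (if x \<subset> y then 1 else 0)
      + real (card {z \<in> G. z \<subset> x \<and> z \<subset> y})"
proof -
  have fin: "finite x" "finite y" and ne: "x \<noteq> {}" "y \<noteq> {}"
    using G(1) x y unfolding simplicial_complex_def by blast+
  consider "card x = 1" | "card y = 1" "card x = 2" | "card x = 2" "card y = 2"
    using card_simplex_cases[OF G] x y by blast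
  then show ?thesis
  proof cases
    case 1
    then obtain v where "x = {v}" by (rule card_1_singletonE)
    with ne(2) show ?thesis
      unfolding card_common_proper_faces[OF assms] by (auto simp: psubset_eq subset_singleton_iff)
  next
    case 2
    then obtain v where "y = {v}" using card_1_singletonE by blast
    with 2 ne(1) show ?thesis
      unfolding card_common_proper_faces[OF assms] by (auto simp: psubset_eq subset_singleton_iff)
  next
    case 3
    then have no: "\<not> x \<subset> y" "\<not> y \<subset> x"
      using fin psubset_card_mono[of x y] psubset_card_mono[of y x] by auto
    have face: "card {z \<in> G. z \<subset> x \<and> z \<subset> y} = card (x \<inter> y)"
      using card_common_proper_faces[OF assms] 3 by simp
    show ?thesis
    proof (cases "x = y")
      case True
      with 3 face show ?thesis by auto
    next
      case False
      have "x \<inter> y \<subset> x"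
        using False no by auto
      then have "card (x \<inter> y) < 2"
        using fin 3 psubset_card_mono by metis
      moreover have "card (x \<inter> y) = 0 \<longleftrightarrow> x \<inter> y = {}"
        using fin by simp
      ultimately show ?thesis
        using False no by (cases "x \<inter> y = {}") (simp_all add: face)
    qed
  qed
qed

definition face_incidence :: "'a set list \<Rightarrow> real mat" where
  "face_incidence xs =
     mat (length xs) (length xs) (\<lambda>(i, j). if xs ! j \<subset> xs ! i then 1 else 0)"

definition parity_mat :: "'a set list \<Rightarrow> real mat" where
  "parity_mat xs =
     mat (length xs) (length xs)
       (\<lambda>(i, j). if i = j then if card (xs ! i) = 1 then 1 else - 1 else 0)"

lemma parity_mat_mult_index:
  assumes "A \<in> carrier_mat (length xs) (length xs)" "i < length xs" "j < length xs"
  shows "(parity_mat xs * A) $$ (i, j) = (if card (xs ! i) = 1 then 1 else - 1) * A $$ (i, j)"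
    and "(A * parity_mat xs) $$ (i, j) = (if card (xs ! j) = 1 then 1 else - 1) * A $$ (i, j)"
  using assms
  by (simp_all add: parity_mat_def scalar_prod_def if_distrib[of "\<lambda>c. c * _"] if_distrib[of "\<lambda>c. _ * c"]
      cong: if_cong)

lemma connection_laplacian_decomposition:
  assumes G: "simplicial_complex G" "one_dimensional G"
    and xs: "distinct xs" "set xs = G"
  defines "N \<equiv> face_incidence xs"
  shows "connection_laplacian xs = parity_mat xs + N + N\<^sup>T + N * N\<^sup>T" (is "_ = ?R")
proof (rule eq_matI)
  fix i j assume "i < dim_row ?R" "j < dim_col ?R"
  then have ij: "i < length xs" "j < length xs"
    by (auto simp: N_def face_incidence_def)
  then have mem: "xs ! i \<in> G" "xs ! j \<in> G"
    using xs by auto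
  have "(N * N\<^sup>T) $$ (i, j) =
      (\<Sum>k = 0..<length xs. if xs ! k \<subset> xs ! i \<and> xs ! k \<subset> xs ! j then 1 else 0)"
    using ij by (auto simp: N_def face_incidence_def scalar_prod_def intro!: sum.cong)
  also have "\<dots> = (\<Sum>z\<in>G. if z \<subset> xs ! i \<and> z \<subset> xs ! j then 1 else 0)"
    using bij_betw_nth[OF xs(1), of "{0..<length xs}" G] xs(2)
    by (intro sum.reindex_bij_betw) (auto simp: lessThan_atLeast0)
  also have "\<dots> = real (card {z \<in> G. z \<subset> xs ! i \<and> z \<subset> xs ! j})"
    unfolding xs(2)[symmetric] by (simp add: sum.If_cases Int_def)
  finally have faces: "(N * N\<^sup>T) $$ (i, j) = real (card {z \<in> G. z \<subset> xs ! i \<and> z \<subset> xs ! j})" .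
  have "connection_laplacian xs $$ (i, j) = (if xs ! i \<inter> xs ! j \<noteq> {} then 1 else 0)"
    using ij by (simp add: connection_laplacian_def)
  also have "\<dots> = parity_mat xs $$ (i, j) + N $$ (i, j) + N\<^sup>T $$ (i, j) + (N * N\<^sup>T) $$ (i, j)"
    unfolding intersection_indicator[OF G mem] faces
    using ij nth_eq_iff_index_eq[OF xs(1) ij]
    by (simp add: parity_mat_def N_def face_incidence_def)
  also have "\<dots> = ?R $$ (i, j)"
    using ij by (simp add: N_def face_incidence_def del: index_mult_mat(1))
  finally show "connection_laplacian xs $$ (i, j) = ?R $$ (i, j)" .
qed (simp_all add: connection_laplacian_def N_def face_incidence_def)

text \<open>
  All relations hold because a nonzero entry of \<open>N\<close> has an edge as its row and a vertex as its
  column. In particular \<open>N * N\<close> vanishes because there are no chains of three simplices.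
\<close>

lemma face_incidence_relations:
  assumes G: "simplicial_complex G" "one_dimensional G" and xs: "set xs = G"
  defines "N \<equiv> face_incidence xs" and "J \<equiv> parity_mat xs" and "n \<equiv> length xs"
  shows "J * J = 1\<^sub>m n" and "N * N = 0\<^sub>m n n" and "N\<^sup>T * N\<^sup>T = 0\<^sub>m n n"
    and "J * N = - N" and "N * J = N" and "J * N\<^sup>T = N\<^sup>T" and "N\<^sup>T * J = - N\<^sup>T"
proof -
  have J: "J \<in> carrier_mat n n" and N: "N \<in> carrier_mat n n"
    by (simp_all add: J_def N_def n_def parity_mat_def face_incidence_def)
  have entry: "N $$ (i, j) = 0 \<or> card (xs ! i) = 2 \<and> card (xs ! j) = 1" if "i < n" "j < n" for i j
  proof (cases "xs ! j \<subset> xs ! i")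
    case True
    then show ?thesis
      using that proper_face_cards[OF G, of "xs ! i" "xs ! j"] nth_mem[of _ xs]
      unfolding xs n_def by simp
  next
    case False
    then show ?thesis
      using that by (simp add: N_def n_def face_incidence_def)
  qed
  note left = parity_mat_mult_index(1)[where xs = xs, folded J_def n_def]
    and right = parity_mat_mult_index(2)[where xs = xs, folded J_def n_def]
  show "J * J = 1\<^sub>m n"
    using J by (intro eq_matI) (auto simp: left simp del: index_mult_mat(1), auto simp: J_def n_def parity_mat_def)
  show NN: "N * N = 0\<^sub>m n n"
  proof (rule eq_matI)
    fix i j assume ij: "i < dim_row (0\<^sub>m n n)" "j < dim_col (0\<^sub>m n n)"
    have "(N * N) $$ (i, j) = (\<Sum>k = 0..<n. N $$ (i, k) * N $$ (k, j))"
      using N ij by (simp add: scalar_prod_def)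
    also have "\<dots> = 0"
    proof (rule sum.neutral, rule ballI)
      fix k assume "k \<in> {0..<n}"
      then show "N $$ (i, k) * N $$ (k, j) = 0"
        using entry[of i k] entry[of k j] ij by auto
    qed
    finally show "(N * N) $$ (i, j) = 0\<^sub>m n n $$ (i, j)"
      using ij by simp
  qed (use N in auto)
  show "N\<^sup>T * N\<^sup>T = 0\<^sub>m n n"
    using transpose_mult[OF N N] by (simp add: NN)
  show "J * N = - N" "N * J = N" "J * N\<^sup>T = N\<^sup>T" "N\<^sup>T * J = - N\<^sup>T"
    using J N entry by (intro eq_matI; fastforce simp: left right simp del: index_mult_mat(1))+
qed

section \<open>Palindromic coefficients\<close>

text \<open>
  With \<open>y = - x\<close>, the functional equation says that a polynomial and its reversal agree at all
  nonzero points, so they have the same coefficients.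
\<close>

lemma palindromic_coefficients:
  fixes p :: "nat \<Rightarrow> real"
  assumes "\<And>x. x \<noteq> 0 \<Longrightarrow> (\<Sum>k = 0..n. p k * (- x) ^ (n - k))
      = (- x) ^ n * (\<Sum>k = 0..n. p k * (- (1 / x)) ^ (n - k))"
    and "k \<le> n"
  shows "p (n - k) = p k"
proof -
  define P where "P = (\<Sum>k\<le>n. monom (p (n - k)) k)"
  define Q where "Q = (\<Sum>k\<le>n. monom (p k) k)"
  have eq: "poly P y = poly Q y" if y: "y \<noteq> 0" for y
  proof -
    have "poly P y = (\<Sum>k\<le>n. p (n - k) * y ^ k)"
      by (simp add: P_def poly_sum poly_monom)
    also have "\<dots> = (\<Sum>k = 0..n. p k * y ^ (n - k))"
      by (rule sum.reindex_bij_witness[of _ "\<lambda>k. n - k" "\<lambda>k. n - k"]) auto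
    also have "\<dots> = y ^ n * (\<Sum>k = 0..n. p k * (1 / y) ^ (n - k))"
      using assms(1)[of "- y"] y by simp
    also have "\<dots> = (\<Sum>k\<le>n. p k * y ^ k)"
      unfolding sum_distrib_left atMost_atLeast0
    proof (rule sum.cong)
      fix k assume "k \<in> {0..n}"
      then have "y ^ n = y ^ (n - k) * y ^ k"
        by (simp flip: power_add)
      then show "y ^ n * (p k * (1 / y) ^ (n - k)) = p k * y ^ k"
        using y by (simp add: power_one_over)
    qed simp
    also have "\<dots> = poly Q y"
      by (simp add: Q_def poly_sum poly_monom)
    finally show ?thesis .
  qed
  have "P = Q"
  proof (rule ccontr)
    assume "P \<noteq> Q"
    then have "finite {y. poly (P - Q) y = 0}"
      by (intro poly_roots_finite) simp
    moreover have "{y. y \<noteq> 0} \<subseteq> {y. poly (P - Q) y = 0}"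
      using eq by auto
    ultimately have "finite {y :: real. y \<noteq> 0}"
      by (rule finite_subset[rotated])
    then have "finite (- {0 :: real})"
      by (simp add: Compl_eq)
    then show False
      using infinite_UNIV_char_0[where 'a = real] by (simp add: finite_compl)
  qed
  then have "coeff P k = coeff Q k" by simp
  then show ?thesis
    using assms(2) by (simp add: P_def Q_def coeff_sum)
qed

theorem corollary5:
  fixes G :: "'a set set" and xs :: "'a set list" and n :: nat
    and L :: "real mat" and p :: "nat \<Rightarrow> real"
  assumes "simplicial_complex G" and "one_dimensional G"
    and "n = card G"
    and "distinct xs" and "set xs = G"
    and "L = connection_laplacian xs"
    and "\<And>x::real. Determinant.det (L ^\<^sub>m 2 - x \<cdot>\<^sub>m 1\<^sub>m n) = (\<Sum>k=0..n. p k * (- x) ^ (n - k))"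
  shows "\<forall>k\<le>n. p (n - k) = p k"
proof -
  have n: "n = length xs"
    using assms(3-5) distinct_card by metis
  define N J where "N = face_incidence xs" and "J = parity_mat xs"
  have N: "N \<in> carrier_mat n n" and J: "J \<in> carrier_mat n n" and T: "N\<^sup>T \<in> carrier_mat n n"
    by (simp_all add: N_def J_def n face_incidence_def parity_mat_def)
  define K S where "K = J + N + N\<^sup>T - N\<^sup>T * N" and "S = N - N\<^sup>T"
  have L: "L = J + N + N\<^sup>T + N * N\<^sup>T"
    unfolding assms(6) N_def J_def
    by (rule connection_laplacian_decomposition[OF assms(1,2,4,5)])
  note relations = graded_factorization_relations[OF J N T
      face_incidence_relations[OF assms(1,2,5), folded n N_def J_def], folded L K_def S_def]
  have carriers: "L \<in> carrier_mat n n" "K \<in> carrier_mat n n" "S \<in> carrier_mat n n"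
    using J N T by (auto simp: L K_def S_def)
  have square: "L ^\<^sub>m 2 = L * L"
    using carriers(1) by (simp add: numeral_2_eq_2)
  have "(\<Sum>k = 0..n. p k * (- x) ^ (n - k))
      = (- x) ^ n * (\<Sum>k = 0..n. p k * (- (1 / x)) ^ (n - k))" if "x \<noteq> 0" for x
    using det_square_reciprocal[OF carriers relations that]
    unfolding assms(7)[unfolded square] .
  then show ?thesis
    using palindromic_coefficients by blast
qed

end
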